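(* Let $(\mathcal A,\mathcal C,E,\delta)$ be a positive flow with phase space $X$, associated continuous map $\alpha:X\to X$ and spectral potential $\lambda:C(X)\to[-\infty,\infty)$. Then $\lambda$ is: (i) monotone: if $\varphi\le\psi$ then $\lambda(\varphi)\le\lambda(\psi)$; (ii) additive homogeneous: $\lambda(\varphi+t)=\lambda(\varphi)+t$ for all $t\in\mathbb R$; (iii) continuous, satisfying the Lipschitz condition $|\lambda(\varphi)-\lambda(\psi)|\le\max_X|\varphi-\psi|$ (that is, $\lambda(\varphi)\le\lambda(\psi)+\max_X|\varphi-\psi|$ for all $\varphi,\psi$; in particular $\lambda$ is either finite everywhere or identically $-\infty$); (iv) strongly $\alpha$-invariant: $\lambda(\varphi+\psi)=\lambda(\varphi+\psi\circ\alpha)$ for all $\varphi,\psi\in C(X)$; and (v) convex with respect to $\varphi\in C(X)$.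
   Context: All algebras are real and associative. A cone in a real vector space is a convex subset $K$ with $tK\subset K$ for $t\ge0$ and such that $v,-v\in K$ imply $v=0$; $u\le v$ means $v-u\in K$. A positive algebra is a real normed algebra $\mathcal A$ ($\|ab\|\le\|a\|\|b\|$) with unit $I$, $\|I\|=1$, and a cone $\mathcal A_+$ closed under products and containing $I$, whose norm is monotone: $\|u\|\le\|u+v\|$ for $u,v\in\mathcal A_+$. A phase subalgebra $\mathcal C\subset\mathcal A$ is a commutative subalgebra containing $I$ such that each $a\in\mathcal C$ satisfies $-tI\le a\le tI$ for some $t>0$. If $\mathcal A_+$ is closed, there is a Hausdorff compact set $X$, unique up to homeomorphism (the phase space), such that $\mathcal C$ is isomorphic, including the order, to a dense subalgebra of $C(X)$ (real continuous functions, supremum norm); $\mathcal C$ is identified with this subalgebra. When $\mathcal A$ is moreover complete, the inclusion $\mathcal C\to\mathcal A$ extends uniquely to a continuous, injective, positive homomorphism $C(X)\to\mathcal A$, by which $C(X)$ is regarded as a subalgebra of $\mathcal A$. A positive flow is a quadruple $(\mathcal A,\mathcal C,E,\delta)$ where $\mathcal A$ is a positive algebra, complete in norm, with closed cone $\mathcal A_+$; $\mathcal C\subset\mathcal A$ is a phase subalgebra; $E\in\mathcal A_+$; and $\delta:\mathcal C\to\mathcal C$ is a positive algebra homomorphism with $\delta(I)=I$ satisfying one of the homological identities $Ef=\delta(f)E$ for all $f\in\mathcal C$ (covariant form) or $fE=E\delta(f)$ for all $f\in\mathcal C$ (contravariant form). There is a unique continuous map $\alpha:X\to X$ with $\delta(f)=f\circ\alpha$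 for $f\in\mathcal C$. The spectral potential is $\lambda(\varphi)=\lim_{n\to\infty}\frac1n\ln\|(e^{\varphi}E)^n\|$, $\varphi\in C(X)$, the logarithm of the spectral radius of $e^\varphi E$ in $\mathcal A$ ($\ln 0=-\infty$). *)

theory Defs
  imports "HOL-Analysis.Analysis"
begin

text \<open>
  Type class \<open>real_normed_algebra_1\<close> supplies the real associative algebra with unit, submultiplicative
  norm and \<open>norm 1 = 1\<close>. The set \<open>P\<close> is the positive cone, and \<open>u \<le> v\<close> means \<open>v - u \<in> P\<close>.
\<close>

locale positive_algebra =
  fixes P :: "'a::real_normed_algebra_1 set"
  assumes convex_P: "convex P"
    and cone_P: "cone P"
    and pointed_P: "\<lbrakk>v \<in> P; - v \<in> P\<rbrakk> \<Longrightarrow> v = 0"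
    and mult_P: "\<lbrakk>u \<in> P; v \<in> P\<rbrakk> \<Longrightarrow> u * v \<in> P"
    and one_P: "1 \<in> P"
    and norm_mono: "\<lbrakk>u \<in> P; v \<in> P\<rbrakk> \<Longrightarrow> norm u \<le> norm (u + v)"

locale phase_subalgebra = positive_algebra P
  for P :: "'a::real_normed_algebra_1 set" +
  fixes C :: "'a set"
  assumes subspace_C: "subspace C"
    and one_C: "1 \<in> C"
    and mult_C: "\<lbrakk>a \<in> C; b \<in> C\<rbrakk> \<Longrightarrow> a * b \<in> C"
    and commute_C: "\<lbrakk>a \<in> C; b \<in> C\<rbrakk> \<Longrightarrow> a * b = b * a"
    and order_bounded_C: "a \<in> C \<Longrightarrow> \<exists>t>0. a - (- t *\<^sub>R 1) \<in> P \<and> t *\<^sub>R 1 - a \<in> P"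

text \<open>The values of \<open>\<delta>\<close> outside \<open>C\<close> are irrelevant.\<close>

locale positive_flow = phase_subalgebra P C
  for P :: "'a::{real_normed_algebra_1, banach} set" and C :: "'a set" +
  fixes E :: 'a and \<delta> :: "'a \<Rightarrow> 'a"
  assumes closed_P: "closed P"
    and E_P: "E \<in> P"
    and \<delta>_C: "f \<in> C \<Longrightarrow> \<delta> f \<in> C"
    and \<delta>_add: "\<lbrakk>f \<in> C; g \<in> C\<rbrakk> \<Longrightarrow> \<delta> (f + g) = \<delta> f + \<delta> g"
    and \<delta>_scaleR: "f \<in> C \<Longrightarrow> \<delta> (r *\<^sub>R f) = r *\<^sub>R \<delta> f"
    and \<delta>_mult: "\<lbrakk>f \<in> C; g \<in> C\<rbrakk> \<Longrightarrow> \<delta> (f * g) = \<delta> f * \<delta> g"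
    and \<delta>_one: "\<delta> 1 = 1"
    and \<delta>_pos: "f \<in> C \<Longrightarrow> f \<in> P \<Longrightarrow> \<delta> f \<in> P"
    and homological: "(\<forall>f\<in>C. E * f = \<delta> f * E) \<or> (\<forall>f\<in>C. f * E = E * \<delta> f)"

text \<open>
  For a compact space \<open>'x\<close>, the type \<open>'x \<Rightarrow>\<^sub>C real\<close> is the space of all continuous real functions on
  \<open>'x\<close>; its norm is the supremum norm. The library does not provide its multiplication.
\<close>

definition cfun_times :: "('x::topological_space \<Rightarrow>\<^sub>C real) \<Rightarrow> ('x \<Rightarrow>\<^sub>C real) \<Rightarrow> ('x \<Rightarrow>\<^sub>C real)"
  where "cfun_times f g = Bcontfun (\<lambda>x. f x * g x)"

definition cfun_exp :: "('x::topological_space \<Rightarrow>\<^sub>C real) \<Rightarrow> ('x \<Rightarrow>\<^sub>C real)"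
  where "cfun_exp f = Bcontfun (\<lambda>x. exp (f x))"

lemma apply_cfun_times: "apply_bcontfun (cfun_times f g) x = f x * g x"
proof -
  have "norm (f y * g y) \<le> norm f * norm g" for y
    using norm_bounded[of f y] norm_bounded[of g y]
    by (auto simp: abs_mult intro!: mult_mono)
  then have "(\<lambda>x. f x * g x) \<in> bcontfun"
    by (intro bcontfun_normI continuous_on_mult) auto
  then show ?thesis
    by (simp add: cfun_times_def Bcontfun_inverse)
qed

lemma apply_cfun_exp: "apply_bcontfun (cfun_exp f) x = exp (f x)"
proof -
  have "norm (exp (f y)) \<le> exp (norm f)" for y
    using norm_bounded[of f y] by auto
  then have "(\<lambda>x. exp (f x)) \<in> bcontfun"
    by (intro bcontfun_normI continuous_on_exp) auto
  then show ?thesis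
    by (simp add: cfun_exp_def Bcontfun_inverse)
qed

text \<open>Meaningful only for continuous \<open>\<alpha>\<close>.\<close>

definition cfun_comp :: "('x::topological_space \<Rightarrow>\<^sub>C real) \<Rightarrow> ('x \<Rightarrow> 'x) \<Rightarrow> ('x \<Rightarrow>\<^sub>C real)"
  where "cfun_comp f \<alpha> = Bcontfun (\<lambda>x. f (\<alpha> x))"

lemma apply_cfun_comp:
  assumes "continuous_on UNIV \<alpha>"
  shows "apply_bcontfun (cfun_comp f \<alpha>) x = f (\<alpha> x)"
proof -
  have "continuous_on UNIV (\<lambda>x. f (\<alpha> x))"
    by (rule continuous_on_compose2[OF _ assms]) auto
  moreover have "bounded (range (\<lambda>x. f (\<alpha> x)))"
    by (rule bounded_subset[OF bounded_apply_bcontfun[of f]]) auto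
  ultimately show ?thesis
    by (simp add: cfun_comp_def Bcontfun_inverse bcontfun_def)
qed

text \<open>
  The type \<open>'x\<close> is a phase space of \<open>C\<close>: \<open>J\<close> identifies \<open>C\<close>, as an ordered algebra, with a dense
  subalgebra of \<open>C('x)\<close>. The values of \<open>J\<close> outside \<open>C\<close> are irrelevant.
\<close>

locale phase_space = phase_subalgebra P C
  for P :: "'a::real_normed_algebra_1 set" and C :: "'a set" +
  fixes J :: "'a \<Rightarrow> ('x::t2_space \<Rightarrow>\<^sub>C real)"
  assumes compact_X: "compact (UNIV :: 'x set)"
    and J_add: "\<lbrakk>f \<in> C; g \<in> C\<rbrakk> \<Longrightarrow> J (f + g) = J f + J g"
    and J_scaleR: "f \<in> C \<Longrightarrow> J (r *\<^sub>R f) = r *\<^sub>R J f"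
    and J_mult: "\<lbrakk>f \<in> C; g \<in> C\<rbrakk> \<Longrightarrow> J (f * g) = cfun_times (J f) (J g)"
    and J_one: "J 1 = const_bcontfun 1"
    and J_order: "f \<in> C \<Longrightarrow> f \<in> P \<longleftrightarrow> (\<forall>x. 0 \<le> J f x)"
    and J_inj: "inj_on J C"
    and J_dense: "closure (J ` C) = UNIV"

definition phase_map :: "'a set \<Rightarrow> ('a \<Rightarrow> 'a) \<Rightarrow> ('a \<Rightarrow> ('x::topological_space \<Rightarrow>\<^sub>C real)) \<Rightarrow> ('x \<Rightarrow> 'x) \<Rightarrow> bool"
  where "phase_map C \<delta> J \<alpha> \<longleftrightarrow>
    continuous_on UNIV \<alpha> \<and> (\<forall>f\<in>C. J (\<delta> f) = cfun_comp (J f) \<alpha>)"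

text \<open>
  \<open>\<iota>\<close> is the continuous injective positive homomorphism from \<open>C('x)\<close> into the ambient algebra that
  extends the inclusion of \<open>C\<close>. It is determined by \<open>J\<close>, because \<open>J ` C\<close> is dense.
\<close>

definition phase_embedding ::
    "'a::real_normed_algebra_1 set \<Rightarrow> 'a set \<Rightarrow> ('a \<Rightarrow> ('x::topological_space \<Rightarrow>\<^sub>C real)) \<Rightarrow> (('x \<Rightarrow>\<^sub>C real) \<Rightarrow> 'a) \<Rightarrow> bool"
  where "phase_embedding P C J \<iota> \<longleftrightarrow>
    linear \<iota> \<and>
    (\<forall>f g. \<iota> (cfun_times f g) = \<iota> f * \<iota> g) \<and>
    continuous_on UNIV \<iota> \<and>
    inj \<iota> \<and>
    (\<forall>f. (\<forall>x. 0 \<le> apply_bcontfun f x) \<longrightarrow> \<iota> f \<in> P) \<and>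
    (\<forall>a\<in>C. \<iota> (J a) = a)"

text \<open>The real \<open>ln\<close> of the library has the value 0 at 0.\<close>

definition eln :: "real \<Rightarrow> ereal"
  where "eln r = (if r = 0 then - \<infinity> else ereal (ln r))"

definition spectral_potential ::
    "(('x::topological_space \<Rightarrow>\<^sub>C real) \<Rightarrow> 'a::real_normed_algebra_1) \<Rightarrow> 'a \<Rightarrow> ('x \<Rightarrow>\<^sub>C real) \<Rightarrow> ereal"
  where "spectral_potential \<iota> E \<phi> =
    lim (\<lambda>n. eln (norm ((\<iota> (cfun_exp \<phi>) * E) ^ n)) / ereal (real n))"

end

theory Submission
  imports Defs
begin

text \<open>
  Everything is read off from the operators \<open>A \<phi> = \<iota> (e\<^sup>\<phi>) E\<close>. By density of the phase subalgebra the
  homological identity extends to all of \<open>C(X)\<close>. Monotonicity is monotonicity of the norm applied to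
  \<open>(A \<phi>)\<^sup>n \<le> (A \<psi>)\<^sup>n\<close>, homogeneity is immediate, and the two together give the Lipschitz bound.
  The homological identity makes \<open>A (\<phi> + \<psi>)\<close> and \<open>A (\<phi> + \<psi> \<circ> \<alpha>)\<close> conjugate by an invertible
  weight, hence of equal spectral radius. For convexity, \<open>(A \<phi>)\<^sup>n\<close> equals \<open>\<iota> (exp (S \<phi>)) E\<^sup>n\<close> or
  \<open>E\<^sup>n \<iota> (exp (S \<phi>))\<close> with \<open>S\<close> linear; Young's inequality for the exponentials, each normalised by
  the norm of the corresponding operator, shows that \<open>\<phi> \<mapsto> \<parallel>(A \<phi>)\<^sup>n\<parallel>\<close> is logarithmically convex for
  every \<open>n\<close>. The limit defining the spectral potential exists by Fekete's lemma.
\<close>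

section \<open>Fekete's lemma with values in \<open>ereal\<close>\<close>

lemma nat_subadditive_le:
  fixes u :: "nat \<Rightarrow> real"
  assumes sub: "\<And>m n. u (m + n) \<le> u m + u n"
  shows "u (q * m + r) \<le> real q * u m + u r"
proof (induction q)
  case (Suc q)
  have "u (m + (q * m + r)) \<le> u m + u (q * m + r)"
    by (rule sub)
  with Suc show ?case
    by (simp add: algebra_simps)
qed simp

text \<open>Division with remainder by a fixed \<open>m > 0\<close> bounds the limsup by
  \<open>u m / m\<close>. As this holds for every such \<open>m\<close>, the limsup is at most the
  liminf. The case \<open>m = 1\<close> excludes \<infinity>, while -\<infinity> remains possible
  because \<open>u\<close> has no lower bound.\<close>

lemma subadditive_ereal_limit:
  fixes u :: "nat \<Rightarrow> real"
  assumes sub: "\<And>m n. u (m + n) \<le> u m + u n"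
  shows "\<exists>L<\<infinity>. (\<lambda>n. ereal (u n / real n)) \<longlonglongrightarrow> L"
proof -
  have limsup_le: "limsup (\<lambda>n. ereal (u n / real n)) \<le> ereal (u m / real m)" if "m > 0" for m
  proof -
    \<comment> \<open>Only the finitely many remainders \<open>r < m\<close> occur, so one constant
      bounds all \<open>u (n mod m)\<close> and vanishes after division by \<open>n\<close>.\<close>
    define K where "K = (\<Sum>r<m. \<bar>u r\<bar>)"
    have K: "u (n mod m) \<le> K" for n
    proof -
      have "\<bar>u (n mod m)\<bar> \<le> K"
        unfolding K_def using that by (intro member_le_sum) auto
      then show ?thesis by linarith
    qed
    \<comment> \<open>The sandwich comes from n/m - 1 \<le> \<open>n div m\<close> \<le> n/m,
      divided by n.\<close>
    have lim1: "(\<lambda>n. real (n div m) / real n) \<longlonglongrightarrow> 1 / real m"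
    proof (rule real_tendsto_sandwich[of "\<lambda>n. 1 / real m - 1 / real n" _ _ "\<lambda>n. 1 / real m"])
      have "(1 / real m - 1 / real n \<le> real (n div m) / real n) \<and> (real (n div m) / real n \<le> 1 / real m)"
        if "n > 0" for n
      proof -
        have "real n = real (n div m) * real m + real (n mod m)"
          by (metis div_mult_mod_eq of_nat_add of_nat_mult)
        moreover have "real (n mod m) < real m"
          using \<open>m > 0\<close> by simp
        ultimately have "real n / real m - 1 \<le> real (n div m)" "real (n div m) \<le> real n / real m"
          using \<open>m > 0\<close> by (auto simp: field_simps)
        then have "(real n / real m - 1) / real n \<le> real (n div m) / real n"
            "real (n div m) / real n \<le> real n / real m / real n"
          by (intro divide_right_mono; simp)+
        then show ?thesis
          using \<open>n > 0\<close> by (simp add: diff_divide_distrib)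
      qed
      then show "\<forall>\<^sub>F n in sequentially. 1 / real m - 1 / real n \<le> real (n div m) / real n"
        "\<forall>\<^sub>F n in sequentially. real (n div m) / real n \<le> 1 / real m"
        by (auto intro: eventually_sequentiallyI[of 1])
      show "(\<lambda>n. 1 / real m - 1 / real n) \<longlonglongrightarrow> 1 / real m"
        using tendsto_diff[OF tendsto_const[of "1 / real m"] lim_1_over_n] by simp
    qed simp
    have "(\<lambda>n. real (n div m) / real n * u m + K * (1 / real n)) \<longlonglongrightarrow> 1 / real m * u m + K * 0"
      by (intro tendsto_intros lim1 lim_1_over_n)
    then have "(\<lambda>n. ereal (real (n div m) / real n * u m + K * (1 / real n))) \<longlonglongrightarrow> ereal (u m / real m)"
      by simp
    then have "limsup (\<lambda>n. ereal (real (n div m) / real n * u m + K * (1 / real n))) = ereal (u m / real m)"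
      by (intro lim_imp_Limsup) auto
    moreover have "u n / real n \<le> real (n div m) / real n * u m + K * (1 / real n)" for n
    proof -
      have "u n \<le> real (n div m) * u m + u (n mod m)"
        using nat_subadditive_le[of u, OF sub, of "n div m" m "n mod m"] by simp
      also have "\<dots> \<le> real (n div m) * u m + K"
        using K by simp
      finally have "u n / real n \<le> (real (n div m) * u m + K) / real n"
        by (intro divide_right_mono) auto
      then show ?thesis
        by (simp add: add_divide_distrib)
    qed
    ultimately show ?thesis
      by (metis (no_types, lifting) Limsup_mono always_eventually ereal_less_eq(3))
  qed
  let ?L = "limsup (\<lambda>n. ereal (u n / real n))"
  have "?L \<le> liminf (\<lambda>n. ereal (u n / real n))"
    by (intro Liminf_bounded eventually_sequentiallyI[of 1] limsup_le) simp
  then have "(\<lambda>n. ereal (u n / real n)) \<longlonglongrightarrow> ?L"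
    by (intro Liminf_eq_Limsup antisym Liminf_le_Limsup) auto
  moreover have "?L < \<infinity>"
    using limsup_le[of 1] by (cases ?L) auto
  ultimately show ?thesis by blast
qed

section \<open>Logarithm of the spectral radius in a normed algebra\<close>

lemma eln_0 [simp]: "eln 0 = -\<infinity>"
  by (simp add: eln_def)

lemma eln_mono: "0 \<le> r \<Longrightarrow> r \<le> s \<Longrightarrow> eln r \<le> eln s"
  by (auto simp: eln_def)

lemma eln_mult: "0 < r \<Longrightarrow> 0 \<le> s \<Longrightarrow> eln (r * s) = ereal (ln r) + eln s"
  by (auto simp: eln_def ln_mult)

lemma eln_divide_nat: "n > 0 \<Longrightarrow> eln r / ereal (real n) = (if r = 0 then -\<infinity> else ereal (ln r / real n))"
  by (auto simp: eln_def)

definition log_spectral_radius :: "'a::real_normed_algebra_1 \<Rightarrow> ereal"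
  where "log_spectral_radius a = lim (\<lambda>n. eln (norm (a ^ n)) / ereal (real n))"

lemma nilpotent_tendsto:
  fixes a :: "'a::real_normed_algebra_1"
  assumes "a ^ k = 0"
  shows "(\<lambda>n. eln (norm (a ^ n)) / ereal (real n)) \<longlonglongrightarrow> -\<infinity>"
proof (rule tendsto_eventually)
  have "a ^ n = 0" if "n \<ge> k" for n
    using that assms by (metis le_add_diff_inverse mult_zero_left power_add)
  then show "\<forall>\<^sub>F n in sequentially. eln (norm (a ^ n)) / ereal (real n) = -\<infinity>"
    by (intro eventually_sequentiallyI[of "Suc k"]) simp
qed

text \<open>If some power vanishes, the sequence is eventually -\<infinity>. Otherwise all
  logarithms are genuine reals, and submultiplicativity of the norm makes them subadditive, so
  Fekete's lemma applies.\<close>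

lemma log_spectral_radius_exists:
  fixes a :: "'a::real_normed_algebra_1"
  shows "\<exists>L<\<infinity>. (\<lambda>n. eln (norm (a ^ n)) / ereal (real n)) \<longlonglongrightarrow> L"
proof (cases "\<exists>k. a ^ k = 0")
  case True
  then have "(\<lambda>n. eln (norm (a ^ n)) / ereal (real n)) \<longlonglongrightarrow> -\<infinity>"
    using nilpotent_tendsto by blast
  then show ?thesis by (intro exI[of _ "-\<infinity>"]) simp
next
  case False
  then have pos: "norm (a ^ k) > 0" for k by simp
  have "ln (norm (a ^ (m + n))) \<le> ln (norm (a ^ m)) + ln (norm (a ^ n))" for m n
  proof -
    have "ln (norm (a ^ (m + n))) \<le> ln (norm (a ^ m) * norm (a ^ n))"
      using pos[of "m + n"] pos[of m] pos[of n] norm_mult_ineq[of "a ^ m" "a ^ n"]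
      by (simp add: power_add)
    then show ?thesis
      using pos[of m] pos[of n] by (simp add: ln_mult)
  qed
  then obtain L where "L < \<infinity>" "(\<lambda>n. ereal (ln (norm (a ^ n)) / real n)) \<longlonglongrightarrow> L"
    using subadditive_ereal_limit[of "\<lambda>n. ln (norm (a ^ n))"] by blast
  moreover have "\<forall>\<^sub>F n in sequentially. ereal (ln (norm (a ^ n)) / real n) = eln (norm (a ^ n)) / ereal (real n)"
    using False by (intro eventually_sequentiallyI[of 1]) (simp add: eln_divide_nat)
  ultimately show ?thesis
    by (intro exI[of _ L] conjI) (auto intro: Lim_transform_eventually)
qed

lemma log_spectral_radius:
  shows log_spectral_radius_tendsto:
      "(\<lambda>n. eln (norm (a ^ n)) / ereal (real n)) \<longlonglongrightarrow> log_spectral_radius a"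
    and log_spectral_radius_less_PInf: "log_spectral_radius a < \<infinity>"
proof -
  obtain L where L: "L < \<infinity>" "(\<lambda>n. eln (norm (a ^ n)) / ereal (real n)) \<longlonglongrightarrow> L"
    using log_spectral_radius_exists by blast
  have "log_spectral_radius a = L"
    unfolding log_spectral_radius_def by (rule limI) (rule L)
  with L show "(\<lambda>n. eln (norm (a ^ n)) / ereal (real n)) \<longlonglongrightarrow> log_spectral_radius a"
    and "log_spectral_radius a < \<infinity>"
    by simp_all
qed

text \<open>The constant contributes \<open>ln K / n\<close>, which tends to 0. Both monotonicity
  and invariance under conjugation reduce to this comparison.\<close>

lemma log_spectral_radius_le:
  assumes "K > 0" and le: "\<And>n. norm (a ^ n) \<le> K * norm (b ^ n)"
  shows "log_spectral_radius a \<le> log_spectral_radius b"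
proof -
  have "(\<lambda>n. ln K * (1 / real n)) \<longlonglongrightarrow> ln K * 0"
    by (intro tendsto_intros lim_1_over_n)
  then have "(\<lambda>n. ereal (ln K / real n)) \<longlonglongrightarrow> 0"
    by (simp add: zero_ereal_def)
  from tendsto_add_ereal_general[OF _ this log_spectral_radius_tendsto[of b]]
  have lim: "(\<lambda>n. ereal (ln K / real n) + eln (norm (b ^ n)) / ereal (real n)) \<longlonglongrightarrow> log_spectral_radius b"
    by simp
  have "eln (norm (a ^ n)) / ereal (real n) \<le> ereal (ln K / real n) + eln (norm (b ^ n)) / ereal (real n)"
    if "n > 0" for n
  proof -
    have "eln (norm (a ^ n)) \<le> ereal (ln K) + eln (norm (b ^ n))"
      using eln_mono[OF _ le[of n]] eln_mult[OF \<open>K > 0\<close>, of "norm (b ^ n)"] by simp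
    then have "eln (norm (a ^ n)) / ereal (real n) \<le> (ereal (ln K) + eln (norm (b ^ n))) / ereal (real n)"
      using that by (intro ereal_divide_right_mono) auto
    then show ?thesis
      using that by (cases "b ^ n = 0") (auto simp: eln_def add_divide_distrib)
  qed
  then show ?thesis
    by (intro LIMSEQ_le[OF log_spectral_radius_tendsto lim] exI[of _ 1]) auto
qed

lemma log_spectral_radius_scaleR:
  assumes "c > 0"
  shows "log_spectral_radius (c *\<^sub>R a) = log_spectral_radius a + ereal (ln c)"
proof (rule LIMSEQ_unique[OF log_spectral_radius_tendsto])
  have "\<forall>\<^sub>F n in sequentially. eln (norm (a ^ n)) / ereal (real n) + ereal (ln c)
      = eln (norm ((c *\<^sub>R a) ^ n)) / ereal (real n)"
    using assms
    by (intro eventually_sequentiallyI[of 1])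
       (auto simp: scaleR_power eln_def ln_mult ln_realpow add_divide_distrib)
  moreover have "(\<lambda>n. eln (norm (a ^ n)) / ereal (real n) + ereal (ln c)) \<longlonglongrightarrow> log_spectral_radius a + ereal (ln c)"
    by (intro tendsto_add_ereal_general log_spectral_radius_tendsto tendsto_const) auto
  ultimately show "(\<lambda>n. eln (norm ((c *\<^sub>R a) ^ n)) / ereal (real n)) \<longlonglongrightarrow> log_spectral_radius a + ereal (ln c)"
    by (rule Lim_transform_eventually[rotated])
qed

text \<open>With \<open>v\<close> the inverse of \<open>u\<close>, \<open>(b * u) ^ n\<close> is the
  conjugate \<open>v * (u * b) ^ n * u\<close>, which costs only the factor
  \<open>norm v * norm u\<close>, independent of \<open>n\<close>.\<close>

lemma log_spectral_radius_le_similar: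
  fixes b u v :: "'a::real_normed_algebra_1"
  assumes "u * v = 1" "v * u = 1"
  shows "log_spectral_radius (b * u) \<le> log_spectral_radius (u * b)"
proof (rule log_spectral_radius_le)
  have power_eq: "(b * u) ^ n = v * (u * b) ^ n * u" for n
  proof (induction n)
    case (Suc n)
    have "(b * u) ^ Suc n = (v * u) * b * u * (v * (u * b) ^ n * u)"
      using Suc assms by simp
    also have "\<dots> = v * (u * b) * (u * v) * (u * b) ^ n * u"
      by (simp only: mult.assoc)
    finally show ?case
      using assms by (simp add: mult.assoc)
  qed (simp add: assms)
  have "u \<noteq> 0" "v \<noteq> 0"
    using assms by auto
  then show "norm v * norm u > 0" by simp
  show "norm ((b * u) ^ n) \<le> norm v * norm u * norm ((u * b) ^ n)" for n
  proof -
    have "norm ((b * u) ^ n) \<le> norm (v * (u * b) ^ n) * norm u"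
      unfolding power_eq by (rule norm_mult_ineq)
    also have "\<dots> \<le> norm v * norm ((u * b) ^ n) * norm u"
      by (intro mult_right_mono norm_mult_ineq) auto
    finally show ?thesis by (simp add: mult_ac)
  qed
qed

lemma log_spectral_radius_commute:
  fixes b u v :: "'a::real_normed_algebra_1"
  assumes "u * v = 1" "v * u = 1"
  shows "log_spectral_radius (b * u) = log_spectral_radius (u * b)"
proof (rule antisym)
  show "log_spectral_radius (b * u) \<le> log_spectral_radius (u * b)"
    by (rule log_spectral_radius_le_similar[OF assms])
  \<comment> \<open>The reverse inequality is the same lemma with \<open>u\<close> and
    \<open>v\<close> exchanged and \<open>u * b * u\<close> in place of \<open>b\<close>.\<close>
  have "u * b = (u * b * u) * v"
    by (simp add: mult.assoc assms)
  moreover have "b * u = v * (u * b * u)"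
    by (simp add: assms flip: mult.assoc)
  ultimately show "log_spectral_radius (u * b) \<le> log_spectral_radius (b * u)"
    using log_spectral_radius_le_similar[of v u "u * b * u"] assms by simp
qed

section \<open>Order properties of the cone and monotonicity of the spectral radius\<close>

context positive_algebra
begin

lemma zero_P: "0 \<in> P"
  using cone_P one_P by (metis cone_0 cone_def scaleR_zero_left order_refl)

lemma scaleR_P: "u \<in> P \<Longrightarrow> 0 \<le> c \<Longrightarrow> c *\<^sub>R u \<in> P"
  using cone_P by (simp add: cone_def)

lemma add_P: "u \<in> P \<Longrightarrow> v \<in> P \<Longrightarrow> u + v \<in> P"
  using convex_P cone_P convex_cone by blast

lemma power_P: "u \<in> P \<Longrightarrow> u ^ n \<in> P"
  by (induction n) (auto intro: one_P mult_P)

lemma power_diff_P: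
  assumes "a \<in> P" "b - a \<in> P"
  shows "b ^ n - a ^ n \<in> P"
proof (induction n)
  case (Suc n)
  have "b \<in> P" using add_P[OF assms] by simp
  \<comment> \<open>This telescoping of the difference of the next powers is valid without
    commutativity, and each factor lies in the cone.\<close>
  then have "b * (b ^ n - a ^ n) + (b - a) * a ^ n \<in> P"
    using Suc assms by (intro add_P mult_P power_P)
  then show ?case by (simp add: algebra_simps)
qed (simp add: zero_P)

lemma norm_mono_diff: "a \<in> P \<Longrightarrow> b - a \<in> P \<Longrightarrow> norm a \<le> norm b"
  using norm_mono[of a "b - a"] by simp

lemma log_spectral_radius_mono:
  "a \<in> P \<Longrightarrow> b - a \<in> P \<Longrightarrow> log_spectral_radius a \<le> log_spectral_radius b"
  by (rule log_spectral_radius_le[of 1]) (auto intro!: norm_mono_diff power_P power_diff_P)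

end

section \<open>Composition and exponential on C(X)\<close>

lemma dist_cfun_comp_le:
  assumes "continuous_on UNIV \<alpha>"
  shows "dist (cfun_comp f \<alpha>) (cfun_comp g \<alpha>) \<le> dist f g"
  by (rule dist_bound) (simp add: apply_cfun_comp[OF assms] dist_bounded)

lemma continuous_cfun_comp:
  assumes "continuous_on UNIV \<alpha>"
  shows "continuous_on UNIV (\<lambda>f. cfun_comp f \<alpha>)"
  unfolding continuous_on_iff
  using dist_cfun_comp_le[OF assms] by (meson order_le_less_trans)

lemma linear_cfun_comp:
  assumes "continuous_on UNIV \<alpha>"
  shows "linear (\<lambda>f. cfun_comp f \<alpha>)"
  by (intro linearI bcontfun_eqI) (simp_all add: apply_cfun_comp[OF assms])

lemma cfun_comp_exp:
  assumes "continuous_on UNIV \<alpha>"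
  shows "cfun_comp (cfun_exp f) \<alpha> = cfun_exp (cfun_comp f \<alpha>)"
  by (rule bcontfun_eqI) (simp add: apply_cfun_comp[OF assms] apply_cfun_exp)

lemma cfun_exp_add: "cfun_exp (f + g) = cfun_times (cfun_exp f) (cfun_exp g)"
  by (rule bcontfun_eqI) (simp add: apply_cfun_times apply_cfun_exp exp_add)

lemma cfun_exp_0: "cfun_exp 0 = const_bcontfun 1"
  by (rule bcontfun_eqI) (simp add: apply_cfun_exp)

section \<open>Properties of the spectral potential, with the flow expressed entirely through
  C(X)\<close>

locale weighted_operator = positive_algebra P
  for P :: "'a::real_normed_algebra_1 set" +
  fixes E :: 'a
    and \<alpha> :: "'x::topological_space \<Rightarrow> 'x"
    and \<iota> :: "('x \<Rightarrow>\<^sub>C real) \<Rightarrow> 'a"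
  assumes E_P: "E \<in> P"
    and continuous_\<alpha>: "continuous_on UNIV \<alpha>"
    and linear_\<iota>: "linear \<iota>"
    and \<iota>_times: "\<iota> (cfun_times f g) = \<iota> f * \<iota> g"
    and \<iota>_one: "\<iota> (const_bcontfun 1) = 1"
    and \<iota>_P: "(\<And>x. 0 \<le> apply_bcontfun f x) \<Longrightarrow> \<iota> f \<in> P"
    and intertwining: "(\<forall>f. E * \<iota> f = \<iota> (cfun_comp f \<alpha>) * E) \<or> (\<forall>f. \<iota> f * E = E * \<iota> (cfun_comp f \<alpha>))"
begin

abbreviation weight :: "('x \<Rightarrow>\<^sub>C real) \<Rightarrow> 'a"
  where "weight \<phi> \<equiv> \<iota> (cfun_exp \<phi>)"

abbreviation \<Lambda> :: "('x \<Rightarrow>\<^sub>C real) \<Rightarrow> ereal"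
  where "\<Lambda> \<equiv> spectral_potential \<iota> E"

lemma \<Lambda>_eq: "\<Lambda> \<phi> = log_spectral_radius (weight \<phi> * E)"
  by (simp add: spectral_potential_def log_spectral_radius_def)

lemma weight_add: "weight (\<phi> + \<psi>) = weight \<phi> * weight \<psi>"
  by (simp add: cfun_exp_add \<iota>_times)

lemma weight_0: "weight 0 = 1"
  by (simp add: cfun_exp_0 \<iota>_one)

lemma weight_minus: "weight \<phi> * weight (- \<phi>) = 1" "weight (- \<phi>) * weight \<phi> = 1"
  by (simp_all flip: weight_add add: weight_0)

lemma weight_const: "weight (\<phi> + const_bcontfun t) = exp t *\<^sub>R weight \<phi>"
proof -
  have "cfun_exp (\<phi> + const_bcontfun t) = exp t *\<^sub>R cfun_exp \<phi>"
    by (rule bcontfun_eqI) (simp add: apply_cfun_exp exp_add)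
  then show ?thesis
    by (simp add: linear_scale[OF linear_\<iota>])
qed

lemma weight_P: "weight \<phi> \<in> P"
  by (simp add: \<iota>_P apply_cfun_exp)

lemma \<iota>_diff_P: "(\<And>x. apply_bcontfun f x \<le> apply_bcontfun g x) \<Longrightarrow> \<iota> g - \<iota> f \<in> P"
  using \<iota>_P[of "g - f"] by (simp add: linear_diff[OF linear_\<iota>])

lemma \<Lambda>_mono:
  assumes "\<And>x. apply_bcontfun \<phi> x \<le> apply_bcontfun \<psi> x"
  shows "\<Lambda> \<phi> \<le> \<Lambda> \<psi>"
proof -
  have "(weight \<psi> - weight \<phi>) * E \<in> P"
    using assms by (intro mult_P \<iota>_diff_P E_P) (simp add: apply_cfun_exp)
  then show ?thesis
    unfolding \<Lambda>_eq by (intro log_spectral_radius_mono mult_P weight_P E_P) (simp add: left_diff_distrib)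
qed

lemma \<Lambda>_add_const: "\<Lambda> (\<phi> + const_bcontfun t) = \<Lambda> \<phi> + ereal t"
  unfolding \<Lambda>_eq weight_const by (simp add: log_spectral_radius_scaleR)

text \<open>Since \<phi> \<le> \<psi> + \<open>norm (\<phi> - \<psi>)\<close> pointwise,
  monotonicity and homogeneity suffice. The one-sided form is meaningful even where the potential is
  -\<infinity>.\<close>

lemma \<Lambda>_lipschitz: "\<Lambda> \<phi> \<le> \<Lambda> \<psi> + ereal (norm (\<phi> - \<psi>))"
proof -
  have "apply_bcontfun \<phi> x \<le> apply_bcontfun (\<psi> + const_bcontfun (norm (\<phi> - \<psi>))) x" for x
    using norm_bounded[of "\<phi> - \<psi>" x] by simp
  then show ?thesis
    unfolding \<Lambda>_add_const[symmetric] by (rule \<Lambda>_mono)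
qed

text \<open>The Lipschitz bound carries a value above -\<infinity> from one function to all others,
  and \<infinity> never occurs.\<close>

lemma \<Lambda>_finite_cases:
  "(\<forall>\<phi>. \<bar>\<Lambda> \<phi>\<bar> \<noteq> \<infinity>) \<or> (\<forall>\<phi>. \<Lambda> \<phi> = -\<infinity>)"
proof (rule disjCI, rule allI)
  fix \<phi>
  assume "\<not> (\<forall>\<phi>. \<Lambda> \<phi> = -\<infinity>)"
  then obtain \<psi> where "\<Lambda> \<psi> \<noteq> -\<infinity>" by blast
  then show "\<bar>\<Lambda> \<phi>\<bar> \<noteq> \<infinity>"
    using \<Lambda>_lipschitz[of \<psi> \<phi>] log_spectral_radius_less_PInf[of "weight \<phi> * E"]
    by (auto simp: \<Lambda>_eq)
qed

text \<open>Finiteness is assumed because in \<open>ereal\<close> the difference of two values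
  -\<infinity> is \<infinity>.\<close>

lemma \<Lambda>_abs_diff_le:
  assumes "\<And>\<phi>. \<bar>\<Lambda> \<phi>\<bar> \<noteq> \<infinity>"
  shows "\<bar>\<Lambda> \<phi> - \<Lambda> \<psi>\<bar> \<le> ereal (norm (\<phi> - \<psi>))"
  using \<Lambda>_lipschitz[of \<phi> \<psi>] \<Lambda>_lipschitz[of \<psi> \<phi>] assms[of \<phi>] assms[of \<psi>]
  by (cases "\<Lambda> \<phi>"; cases "\<Lambda> \<psi>") (auto simp: norm_minus_commute)

lemma \<Lambda>_continuous: "continuous_on UNIV \<Lambda>"
  using \<Lambda>_finite_cases
proof
  assume fin: "\<forall>\<phi>. \<bar>\<Lambda> \<phi>\<bar> \<noteq> \<infinity>"
  then have eq: "\<Lambda> \<phi> = ereal (real_of_ereal (\<Lambda> \<phi>))" for \<phi>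
    by (simp add: ereal_real)
  have "\<bar>real_of_ereal (\<Lambda> \<phi>) - real_of_ereal (\<Lambda> \<psi>)\<bar> \<le> norm (\<phi> - \<psi>)" for \<phi> \<psi>
    using \<Lambda>_abs_diff_le[of \<phi> \<psi>] fin eq[of \<phi>] eq[of \<psi>]
    by (metis abs_ereal.simps(1) ereal_less_eq(3) ereal_minus(1))
  then have "continuous_on UNIV (\<lambda>\<phi>. real_of_ereal (\<Lambda> \<phi>))"
    unfolding continuous_on_iff dist_norm real_norm_def by (meson order_le_less_trans)
  then have "continuous_on UNIV (\<lambda>\<phi>. ereal (real_of_ereal (\<Lambda> \<phi>)))"
    by (rule continuous_on_ereal)
  then show ?thesis using eq by simp
next
  assume "\<forall>\<phi>. \<Lambda> \<phi> = -\<infinity>"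
  then have "\<Lambda> = (\<lambda>\<phi>. -\<infinity>)" by blast
  then show ?thesis by simp
qed

lemma weight_intertwining:
  "(\<forall>\<phi>. E * weight \<phi> = weight (cfun_comp \<phi> \<alpha>) * E) \<or> (\<forall>\<phi>. weight \<phi> * E = E * weight (cfun_comp \<phi> \<alpha>))"
  using intertwining by (metis cfun_comp_exp[OF continuous_\<alpha>])

lemma \<Lambda>_invariant: "\<Lambda> (\<phi> + \<psi>) = \<Lambda> (\<phi> + cfun_comp \<psi> \<alpha>)"
  using weight_intertwining
proof
  assume "\<forall>\<phi>. E * weight \<phi> = weight (cfun_comp \<phi> \<alpha>) * E"
  \<comment> \<open>The identity moves the weight of \<psi> \<circ> \<alpha> to the right of
    \<open>E\<close>, where it becomes \<open>weight \<psi>\<close>. The two operators then differ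
    only by the side on which this invertible factor stands.\<close>
  then have "weight \<phi> * (weight (cfun_comp \<psi> \<alpha>) * E) = weight \<phi> * (E * weight \<psi>)"
    by metis
  then have "weight (\<phi> + cfun_comp \<psi> \<alpha>) * E = (weight \<phi> * E) * weight \<psi>"
    by (simp add: weight_add mult.assoc)
  moreover have "weight (\<phi> + \<psi>) * E = weight \<psi> * (weight \<phi> * E)"
    by (subst add.commute) (simp add: weight_add mult.assoc)
  ultimately show ?thesis
    unfolding \<Lambda>_eq using log_spectral_radius_commute[OF weight_minus, of "weight \<phi> * E" \<psi>] by simp
next
  assume "\<forall>\<phi>. weight \<phi> * E = E * weight (cfun_comp \<phi> \<alpha>)"
  \<comment> \<open>Here the roles are exchanged: the invertible factor that changes sides is the
    weight of \<psi> \<circ> \<alpha>.\<close>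
  then have "weight \<phi> * (weight \<psi> * E) = weight \<phi> * (E * weight (cfun_comp \<psi> \<alpha>))"
    by metis
  then have "weight (\<phi> + \<psi>) * E = (weight \<phi> * E) * weight (cfun_comp \<psi> \<alpha>)"
    by (simp add: weight_add mult.assoc)
  moreover have "weight (\<phi> + cfun_comp \<psi> \<alpha>) * E = weight (cfun_comp \<psi> \<alpha>) * (weight \<phi> * E)"
    by (subst add.commute) (simp add: weight_add mult.assoc)
  ultimately show ?thesis
    unfolding \<Lambda>_eq
    using log_spectral_radius_commute[OF weight_minus, of "weight \<phi> * E" "cfun_comp \<psi> \<alpha>"] by simp
qed

text \<open>\<open>S\<close> is a Birkhoff sum: of \<phi> \<circ> \<alpha>^k over 0 \<le> k < n in
  the covariant form, over 1 \<le> k \<le> n in the contravariant form. It depends on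
  \<open>n\<close> but not on \<phi>, and its linearity lets convex combinations pass
  through.\<close>

lemma power_weighted:
  "\<exists>S. linear S \<and> ((\<forall>\<phi>. (weight \<phi> * E) ^ n = weight (S \<phi>) * E ^ n) \<or>
                   (\<forall>\<phi>. (weight \<phi> * E) ^ n = E ^ n * weight (S \<phi>)))"
  using weight_intertwining
proof
  assume cov: "\<forall>\<phi>. E * weight \<phi> = weight (cfun_comp \<phi> \<alpha>) * E"
  have "\<exists>S. linear S \<and> (\<forall>\<phi>. (weight \<phi> * E) ^ n = weight (S \<phi>) * E ^ n)"
  proof (induction n)
    case 0
    show ?case by (rule exI[of _ "\<lambda>_. 0"]) (simp add: weight_0 linear_zero)
  next
    case (Suc n)
    then obtain S where S: "linear S" "\<And>\<phi>. (weight \<phi> * E) ^ n = weight (S \<phi>) * E ^ n" by blast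
    have "linear (\<lambda>\<phi>. \<phi> + cfun_comp (S \<phi>) \<alpha>)"
      using linear_compose[OF S(1) linear_cfun_comp[OF continuous_\<alpha>]]
      by (intro linear_compose_add linear_ident) (simp add: o_def)
    moreover have "(weight \<phi> * E) ^ Suc n = weight (\<phi> + cfun_comp (S \<phi>) \<alpha>) * E ^ Suc n" for \<phi>
    proof -
      have "(weight \<phi> * E) ^ Suc n = weight \<phi> * (E * weight (S \<phi>)) * E ^ n"
        by (simp add: S(2) mult.assoc)
      also have "\<dots> = weight \<phi> * (weight (cfun_comp (S \<phi>) \<alpha>) * E) * E ^ n"
        by (simp only: cov[rule_format])
      finally show ?thesis
        by (simp add: weight_add mult.assoc)
    qed
    ultimately show ?case by blast
  qed
  then show ?thesis by blast
next
  assume contra: "\<forall>\<phi>. weight \<phi> * E = E * weight (cfun_comp \<phi> \<alpha>)"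
  have "\<exists>S. linear S \<and> (\<forall>\<phi>. (weight \<phi> * E) ^ n = E ^ n * weight (S \<phi>))"
  proof (induction n)
    case 0
    show ?case by (rule exI[of _ "\<lambda>_. 0"]) (simp add: weight_0 linear_zero)
  next
    case (Suc n)
    then obtain S where S: "linear S" "\<And>\<phi>. (weight \<phi> * E) ^ n = E ^ n * weight (S \<phi>)" by blast
    have "linear (\<lambda>\<phi>. cfun_comp (S \<phi> + \<phi>) \<alpha>)"
      using linear_compose[OF linear_compose_add[OF S(1) linear_ident] linear_cfun_comp[OF continuous_\<alpha>]]
      by (simp add: o_def)
    moreover have "(weight \<phi> * E) ^ Suc n = E ^ Suc n * weight (cfun_comp (S \<phi> + \<phi>) \<alpha>)" for \<phi>
    proof -
      \<comment> \<open>The new factor is split off on the right, next to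
        \<open>weight (S \<phi>)\<close>, so that the combined weight can then cross
        \<open>E\<close>.\<close>
      have "(weight \<phi> * E) ^ Suc n = E ^ n * (weight (S \<phi> + \<phi>) * E)"
        by (simp add: power_Suc2 S(2) weight_add mult.assoc del: power_Suc)
      also have "\<dots> = E ^ n * (E * weight (cfun_comp (S \<phi> + \<phi>) \<alpha>))"
        by (simp only: contra[rule_format])
      finally show ?thesis
        by (simp add: power_Suc2 mult.assoc del: power_Suc)
    qed
    ultimately show ?case by blast
  qed
  then show ?thesis by blast
qed

text \<open>Pointwise this is Young's inequality x^(1-t) y^t \<le> (1-t) x + t y for x = e^f / a and
  y = e^g / b, and \<iota> preserves the order.\<close>

lemma weight_convex:
  assumes "a > 0" "b > 0" "0 \<le> t" "t \<le> 1"
  shows "((1 - t) / a) *\<^sub>R weight f + (t / b) *\<^sub>R weight g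
    - (1 / (a powr (1 - t) * b powr t)) *\<^sub>R weight ((1 - t) *\<^sub>R f + t *\<^sub>R g) \<in> P"
proof -
  let ?l = "(1 / (a powr (1 - t) * b powr t)) *\<^sub>R cfun_exp ((1 - t) *\<^sub>R f + t *\<^sub>R g)"
  let ?r = "((1 - t) / a) *\<^sub>R cfun_exp f + (t / b) *\<^sub>R cfun_exp g"
  have "apply_bcontfun ?l x \<le> apply_bcontfun ?r x" for x
  proof -
    have "exp ((1 - t) * f x + t * g x) / (a powr (1 - t) * b powr t)
        = (exp (f x) / a) powr (1 - t) * (exp (g x) / b) powr t"
      using assms by (simp add: powr_divide exp_powr_real exp_add mult.commute)
    also have "\<dots> \<le> (1 - t) * (exp (f x) / a) + t * (exp (g x) / b)"
      using assms by (intro Youngs_inequality_0) auto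
    finally show ?thesis
      by (simp add: apply_cfun_exp)
  qed
  from \<iota>_diff_P[OF this] show ?thesis
    by (simp add: linear_add[OF linear_\<iota>] linear_scale[OF linear_\<iota>])
qed

text \<open>After division by their norms \<open>a\<close> and \<open>b\<close>, the two powers have
  a convex combination of norm at most 1. By Young's inequality it dominates the power for \<theta>
  divided by \<open>c\<close>, so monotonicity of the norm yields the bound
  \<open>c\<close>.\<close>

lemma norm_power_convex:
  assumes "0 \<le> t" "t \<le> 1"
    and "(weight \<phi> * E) ^ n \<noteq> 0" "(weight \<psi> * E) ^ n \<noteq> 0"
  shows "norm ((weight ((1 - t) *\<^sub>R \<phi> + t *\<^sub>R \<psi>) * E) ^ n)
    \<le> norm ((weight \<phi> * E) ^ n) powr (1 - t) * norm ((weight \<psi> * E) ^ n) powr t"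
proof -
  let ?A = "\<lambda>\<phi>. (weight \<phi> * E) ^ n"
  define \<theta> where "\<theta> = (1 - t) *\<^sub>R \<phi> + t *\<^sub>R \<psi>"
  define a b c where "a = norm (?A \<phi>)" and "b = norm (?A \<psi>)" and "c = a powr (1 - t) * b powr t"
  have pos: "a > 0" "b > 0" "c > 0"
    using assms by (auto simp: a_def b_def c_def)
  obtain S where S: "linear S"
    "(\<forall>\<phi>. ?A \<phi> = weight (S \<phi>) * E ^ n) \<or> (\<forall>\<phi>. ?A \<phi> = E ^ n * weight (S \<phi>))"
    using power_weighted by blast
  have S\<theta>: "S \<theta> = (1 - t) *\<^sub>R S \<phi> + t *\<^sub>R S \<psi>"
    by (simp add: \<theta>_def linear_add[OF S(1)] linear_scale[OF S(1)])
  define d where "d = ((1 - t) / a) *\<^sub>R weight (S \<phi>) + (t / b) *\<^sub>R weight (S \<psi>) - (1 / c) *\<^sub>R weight (S \<theta>)"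
  have d: "d \<in> P"
    unfolding d_def S\<theta> c_def using pos assms by (intro weight_convex) auto
  \<comment> \<open>\<open>E ^ n\<close> stands on the same side in all three powers, so it factors
    out of the combination and leaves \<open>d\<close>.\<close>
  have "((1 - t) / a) *\<^sub>R ?A \<phi> + (t / b) *\<^sub>R ?A \<psi> - (1 / c) *\<^sub>R ?A \<theta> \<in> P"
    using S(2)
  proof
    assume A: "\<forall>\<phi>. ?A \<phi> = weight (S \<phi>) * E ^ n"
    have "((1 - t) / a) *\<^sub>R ?A \<phi> + (t / b) *\<^sub>R ?A \<psi> - (1 / c) *\<^sub>R ?A \<theta> = d * E ^ n"
      unfolding d_def A[rule_format] by (simp add: algebra_simps)
    then show ?thesis
      using mult_P[OF d power_P[OF E_P]] by simp
  next
    assume A: "\<forall>\<phi>. ?A \<phi> = E ^ n * weight (S \<phi>)"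
    have "((1 - t) / a) *\<^sub>R ?A \<phi> + (t / b) *\<^sub>R ?A \<psi> - (1 / c) *\<^sub>R ?A \<theta> = E ^ n * d"
      unfolding d_def A[rule_format] by (simp add: algebra_simps)
    then show ?thesis
      using mult_P[OF power_P[OF E_P] d] by simp
  qed
  then have "norm ((1 / c) *\<^sub>R ?A \<theta>) \<le> norm (((1 - t) / a) *\<^sub>R ?A \<phi> + (t / b) *\<^sub>R ?A \<psi>)"
    using pos by (intro norm_mono_diff scaleR_P power_P mult_P weight_P E_P) auto
  also have "\<dots> \<le> (1 - t) / a * a + t / b * b"
    using assms pos by (intro norm_triangle_le) (simp add: a_def b_def)
  also have "\<dots> = 1"
    using pos by simp
  finally show ?thesis
    using pos by (simp add: \<theta>_def c_def a_def b_def divide_simps)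
qed

lemma \<Lambda>_convex:
  assumes "0 \<le> t" "t \<le> 1"
  shows "\<Lambda> ((1 - t) *\<^sub>R \<phi> + t *\<^sub>R \<psi>) \<le> ereal (1 - t) * \<Lambda> \<phi> + ereal t * \<Lambda> \<psi>"
proof -
  \<comment> \<open>The endpoints are settled by 0 * (-\<infinity>) = 0 in \<open>ereal\<close>. If
    the potential is identically -\<infinity> and 0 < t < 1, both coefficients are positive and the
    right side is -\<infinity>.\<close>
  consider "t = 0" | "t = 1" | "\<forall>\<phi>. \<Lambda> \<phi> = -\<infinity>" "0 < t" "t < 1" | "\<forall>\<phi>. \<bar>\<Lambda> \<phi>\<bar> \<noteq> \<infinity>"
    using \<Lambda>_finite_cases assms by force
  then show ?thesis
  proof cases
    case 4
    let ?c = "\<lambda>\<phi> n. eln (norm ((weight \<phi> * E) ^ n)) / ereal (real n)"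
    have lim: "?c \<phi> \<longlonglongrightarrow> \<Lambda> \<phi>" for \<phi>
      unfolding \<Lambda>_eq by (rule log_spectral_radius_tendsto)
    \<comment> \<open>A vanishing power would force the value -\<infinity>. Hence every norm below
      is positive and its logarithm is the real one.\<close>
    have nz: "(weight \<phi> * E) ^ n \<noteq> 0" for \<phi> n
    proof
      assume 0: "(weight \<phi> * E) ^ n = 0"
      have "\<Lambda> \<phi> = -\<infinity>"
        by (rule LIMSEQ_unique[OF lim nilpotent_tendsto[OF 0]])
      with 4[rule_format, of \<phi>] show False by simp
    qed
    have "(\<lambda>n. ereal (1 - t) * ?c \<phi> n + ereal t * ?c \<psi> n) \<longlonglongrightarrow> ereal (1 - t) * \<Lambda> \<phi> + ereal t * \<Lambda> \<psi>"
      using 4[rule_format, of \<phi>] 4[rule_format, of \<psi>]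
      by (intro tendsto_add_ereal_general tendsto_cmult_ereal lim) auto
    moreover have "?c ((1 - t) *\<^sub>R \<phi> + t *\<^sub>R \<psi>) n \<le> ereal (1 - t) * ?c \<phi> n + ereal t * ?c \<psi> n" if "n > 0" for n
    proof -
      define x y z where "x = norm ((weight \<phi> * E) ^ n)" and "y = norm ((weight \<psi> * E) ^ n)"
        and "z = norm ((weight ((1 - t) *\<^sub>R \<phi> + t *\<^sub>R \<psi>) * E) ^ n)"
      have pos: "x > 0" "y > 0" "z > 0"
        by (simp_all add: x_def y_def z_def nz)
      have "z \<le> x powr (1 - t) * y powr t"
        unfolding x_def y_def z_def by (intro norm_power_convex assms nz)
      then have "ln z \<le> ln (x powr (1 - t) * y powr t)"
        using pos by simp
      also have "\<dots> = (1 - t) * ln x + t * ln y"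
        using pos by (simp add: ln_mult ln_powr)
      finally have "ln z / real n \<le> ((1 - t) * ln x + t * ln y) / real n"
        by (intro divide_right_mono) auto
      then show ?thesis
        using that pos unfolding x_def[symmetric] y_def[symmetric] z_def[symmetric]
        by (simp add: eln_divide_nat add_divide_distrib)
    qed
    ultimately show ?thesis
      by (intro LIMSEQ_le[OF lim]) (auto intro!: exI[of _ 1])
  qed (simp_all flip: zero_ereal_def)
qed

end

section \<open>From a positive flow to weighted operators over C(X)\<close>

lemma weighted_operatorI:
  fixes P C :: "'a::{real_normed_algebra_1, banach} set"
    and J :: "'a \<Rightarrow> ('x::t2_space \<Rightarrow>\<^sub>C real)"
  assumes "positive_flow P C E \<delta>"
    and "phase_space P C J"
    and "phase_map C \<delta> J \<alpha>"
    and "phase_embedding P C J \<iota>"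
  shows "weighted_operator P E \<alpha> \<iota>"
proof -
  interpret flow: positive_flow P C E \<delta> by fact
  interpret space: phase_space P C J by fact
  have \<alpha>: "continuous_on UNIV \<alpha>" and J\<delta>: "\<And>f. f \<in> C \<Longrightarrow> J (\<delta> f) = cfun_comp (J f) \<alpha>"
    using assms(3) by (auto simp: phase_map_def)
  have \<iota>: "linear \<iota>" "\<And>f g. \<iota> (cfun_times f g) = \<iota> f * \<iota> g" "continuous_on UNIV \<iota>"
    "\<And>f. (\<And>x. 0 \<le> apply_bcontfun f x) \<Longrightarrow> \<iota> f \<in> P" "\<And>a. a \<in> C \<Longrightarrow> \<iota> (J a) = a"
    using assms(4) by (auto simp: phase_embedding_def)
  have comp: "continuous_on UNIV (\<lambda>f. \<iota> (cfun_comp f \<alpha>))"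
    by (rule continuous_on_compose2[OF \<iota>(3) continuous_cfun_comp[OF \<alpha>]]) simp
  have \<iota>\<delta>: "\<iota> (cfun_comp (J f) \<alpha>) = \<delta> f" if "f \<in> C" for f
    using that by (metis J\<delta> \<iota>(5) flow.\<delta>_C)
  \<comment> \<open>Each homological identity is a closed condition on \<open>f\<close>, by
    continuity of \<iota> and of composition with \<alpha>, so it spreads from the dense image of
    \<open>C\<close> to C(X).\<close>
  have dense: "Q = UNIV" if "closed Q" "J ` C \<subseteq> Q" for Q
    using closure_minimal[OF that(2,1)] space.J_dense by blast
  have "(\<forall>f. E * \<iota> f = \<iota> (cfun_comp f \<alpha>) * E) \<or> (\<forall>f. \<iota> f * E = E * \<iota> (cfun_comp f \<alpha>))"
    using flow.homological
  proof
    assume "\<forall>f\<in>C. E * f = \<delta> f * E"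
    then have "J ` C \<subseteq> {f. E * \<iota> f = \<iota> (cfun_comp f \<alpha>) * E}"
      by (auto simp: \<iota>(5) \<iota>\<delta>)
    moreover have "closed {f. E * \<iota> f = \<iota> (cfun_comp f \<alpha>) * E}"
      by (intro closed_Collect_eq continuous_intros \<iota>(3) comp)
    ultimately show ?thesis using dense by blast
  next
    assume "\<forall>f\<in>C. f * E = E * \<delta> f"
    then have "J ` C \<subseteq> {f. \<iota> f * E = E * \<iota> (cfun_comp f \<alpha>)}"
      by (auto simp: \<iota>(5) \<iota>\<delta>)
    moreover have "closed {f. \<iota> f * E = E * \<iota> (cfun_comp f \<alpha>)}"
      by (intro closed_Collect_eq continuous_intros \<iota>(3) comp)
    ultimately show ?thesis using dense by blast
  qed
  \<comment> \<open>Unitality of \<iota> is inherited from \<open>C\<close>, which contains the unit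
    and on which \<iota> inverts \<open>J\<close>.\<close>
  moreover have "\<iota> (const_bcontfun 1) = 1"
    using \<iota>(5)[OF flow.one_C] by (simp add: space.J_one)
  ultimately show ?thesis
    by unfold_locales (auto intro: \<alpha> \<iota> flow.E_P linear_add[OF \<iota>(1)] linear_scale[OF \<iota>(1)])
qed

theorem theorem5p3:
  fixes P C :: "'a::{real_normed_algebra_1, banach} set"
    and E :: 'a
    and \<delta> :: "'a \<Rightarrow> 'a"
    and J :: "'a \<Rightarrow> ('x::t2_space \<Rightarrow>\<^sub>C real)"
    and \<alpha> :: "'x \<Rightarrow> 'x"
    and \<iota> :: "('x \<Rightarrow>\<^sub>C real) \<Rightarrow> 'a"
  assumes "positive_flow P C E \<delta>"
    and "phase_space P C J"
    and "phase_map C \<delta> J \<alpha>"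
    and "phase_embedding P C J \<iota>"
  shows
    "(\<forall>\<phi> \<psi>. (\<forall>x. apply_bcontfun \<phi> x \<le> apply_bcontfun \<psi> x) \<longrightarrow> spectral_potential \<iota> E \<phi> \<le> spectral_potential \<iota> E \<psi>)
    \<and> (\<forall>\<phi> t. spectral_potential \<iota> E (\<phi> + const_bcontfun t) = spectral_potential \<iota> E \<phi> + ereal t)
    \<and> (continuous_on UNIV (spectral_potential \<iota> E)
        \<and> (\<forall>\<phi> \<psi>. spectral_potential \<iota> E \<phi> \<le> spectral_potential \<iota> E \<psi> + ereal (norm (\<phi> - \<psi>)))
        \<and> ((\<forall>\<phi>. \<bar>spectral_potential \<iota> E \<phi>\<bar> \<noteq> \<infinity>)
              \<and> (\<forall>\<phi> \<psi>. \<bar>spectral_potential \<iota> E \<phi> - spectral_potential \<iota> E \<psi>\<bar> \<le> ereal (norm (\<phi> - \<psi>)))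
            \<or> (\<forall>\<phi>. spectral_potential \<iota> E \<phi> = - \<infinity>)))
    \<and> (\<forall>\<phi> \<psi>. spectral_potential \<iota> E (\<phi> + \<psi>) = spectral_potential \<iota> E (\<phi> + cfun_comp \<psi> \<alpha>))
    \<and> (\<forall>\<phi> \<psi>. \<forall>t\<in>{0..1}. spectral_potential \<iota> E ((1 - t) *\<^sub>R \<phi> + t *\<^sub>R \<psi>)
          \<le> ereal (1 - t) * spectral_potential \<iota> E \<phi> + ereal t * spectral_potential \<iota> E \<psi>)"
proof -
  interpret weighted_operator P E \<alpha> \<iota>
    using assms by (rule weighted_operatorI)
  show ?thesis
    using \<Lambda>_finite_cases \<Lambda>_abs_diff_le
    by (intro conjI allI ballI impI \<Lambda>_mono \<Lambda>_add_const \<Lambda>_continuous \<Lambda>_lipschitz \<Lambda>_invariant \<Lambda>_convex) auto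
qed

end
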